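(* Let $n$ and $k$ be positive integers such that $n-k$ is odd and $\frac{n+1}{3}\leq k\leq n-1$. Then there exists a (simple, undirected) graph $G$ with $n$ vertices and connectivity $k$ containing two adjacent vertices $x$ and $y$ with $d_x=d_y=k$ such that $$\kappa_{LLY}(x,y)=\frac{2k-n+2}{k}.$$
   Context: The connectivity of a non-complete graph is the minimum number of vertices whose removal disconnects it; for $K_n$ it is $n-1$. $d(x,y)$ is the graph distance and $d_x$ the degree of $x$. For $p\in[0,1]$ and a vertex $x$, $\mu_x^p$ is the probability measure with $\mu_x^p(x)=p$, $\mu_x^p(y)=\frac{1-p}{d_x}$ if $y$ is adjacent to $x$, and $0$ otherwise. For probability measures $\mu_1,\mu_2$ on $V$, $W(\mu_1,\mu_2)=\inf_\pi\sum_{x,y}d(x,y)\pi(x,y)$ over all $\pi:V\times V\to[0,1]$ with marginals $\mu_1$ and $\mu_2$. For distinct vertices $x,y$, $\kappa_p(x,y)=1-\frac{W(\mu_x^p,\mu_y^p)}{d(x,y)}$ and $\kappa_{LLY}(x,y)=\lim_{p\to1}\frac{\kappa_p(x,y)}{1-p}$. *)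

theory Defs
  imports Complex_Main "Graph_Theory.Graph_Theory"
begin

text \<open>
  A finite simple undirected graph is a digraph satisfying \<^locale>\<open>graph\<close>: finite, loop-free,
  without parallel arcs, and symmetric, so that each edge is a pair of opposite arcs. Hence the
  degree of a vertex is its \<^const>\<open>out_degree\<close>.
\<close>

text \<open>
  The library counts the null graph as not connected. This does not affect the minimum:
  in a non-complete graph, removing all vertices but two non-adjacent ones already disconnects it.
\<close>

definition connectivity :: "('a, 'b) pre_digraph \<Rightarrow> nat" where
  "connectivity G =
     (if complete_digraph (card (verts G)) G then card (verts G) - 1
      else (LEAST m. \<exists>S \<subseteq> verts G. card S = m \<and>
              \<not> Digraph_Component.connected (induce_subgraph G (verts G - S))))"

text \<open>Meaningful only when \<open>v\<close> is reachable from \<open>u\<close>.\<close>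

definition graph_dist :: "('a, 'b) pre_digraph \<Rightarrow> 'a \<Rightarrow> 'a \<Rightarrow> nat" where
  "graph_dist G u v = (LEAST m. \<exists>w. pre_digraph.awalk G u w v \<and> length w = m)"

definition lazy_measure :: "('a, 'b) pre_digraph \<Rightarrow> real \<Rightarrow> 'a \<Rightarrow> 'a \<Rightarrow> real" where
  "lazy_measure G p x y =
     (if y = x then p
      else if x \<rightarrow>\<^bsub>G\<^esub> y then (1 - p) / real (out_degree G x)
      else 0)"

definition couplings ::
  "('a, 'b) pre_digraph \<Rightarrow> ('a \<Rightarrow> real) \<Rightarrow> ('a \<Rightarrow> real) \<Rightarrow> ('a \<Rightarrow> 'a \<Rightarrow> real) set" where
  "couplings G \<mu>1 \<mu>2 =
     {\<pi>. (\<forall>x\<in>verts G. \<forall>y\<in>verts G. \<pi> x y \<in> {0..1}) \<and>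
         (\<forall>x\<in>verts G. (\<Sum>y\<in>verts G. \<pi> x y) = \<mu>1 x) \<and>
         (\<forall>y\<in>verts G. (\<Sum>x\<in>verts G. \<pi> x y) = \<mu>2 y)}"

definition wasserstein ::
  "('a, 'b) pre_digraph \<Rightarrow> ('a \<Rightarrow> real) \<Rightarrow> ('a \<Rightarrow> real) \<Rightarrow> real" where
  "wasserstein G \<mu>1 \<mu>2 =
     (INF \<pi>\<in>couplings G \<mu>1 \<mu>2.
        \<Sum>x\<in>verts G. \<Sum>y\<in>verts G. real (graph_dist G x y) * \<pi> x y)"

definition ollivier_curvature :: "('a, 'b) pre_digraph \<Rightarrow> real \<Rightarrow> 'a \<Rightarrow> 'a \<Rightarrow> real" where
  "ollivier_curvature G p x y =
     1 - wasserstein G (lazy_measure G p x) (lazy_measure G p y) / real (graph_dist G x y)"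

text \<open>
  The Lin--Lu--Yau curvature is stated as a relation, so that asserting its value includes the
  existence of the limit. The limit is from the left since \<open>p\<close> ranges over \<open>[0,1]\<close>.
\<close>

definition has_LLY_curvature :: "('a, 'b) pre_digraph \<Rightarrow> 'a \<Rightarrow> 'a \<Rightarrow> real \<Rightarrow> bool" where
  "has_LLY_curvature G x y c \<longleftrightarrow>
     ((\<lambda>p. ollivier_curvature G p x y / (1 - p)) \<longlongrightarrow> c) (at_left 1)"

end

theory Submission
  imports Defs
begin

text \<open>
  Put \<open>m = (n - k - 1) / 2\<close> and \<open>t = k - 1 - m\<close>; the hypotheses on \<open>n\<close> and \<open>k\<close> say exactly that
  these are natural numbers. Blow up a pentagon to parts of sizes \<open>1, m, m, m, 1\<close>, where the two
  single vertices \<open>x\<close> and \<open>y\<close> are consecutive, and join it to a clique of size \<open>t\<close>. A separating set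
  contains this clique and two non-consecutive parts of the pentagon, at most one of which is a
  single vertex, so for \<open>m > 0\<close> the connectivity is \<open>t + m + 1 = k\<close>.
  The \<open>m\<close> neighbours of \<open>x\<close> alone and the \<open>m\<close> neighbours of \<open>y\<close> alone are pairwise at distance
  two, so transporting one measure to the other costs two units per pair. The potential with value
  two on the former set, zero on \<open>y\<close> and the latter set, and one elsewhere shows that this is
  optimal. This gives the curvature \<open>(k + 1 - 2 m) / k\<close>.
\<close>

section \<open>Graph distance\<close>

lemma graph_dist_le: "pre_digraph.awalk G u w v \<Longrightarrow> graph_dist G u v \<le> length w"
  unfolding graph_dist_def by (rule Least_le) blast

context wf_digraph
begin

lemma graph_dist_awalk:
  assumes "u \<rightarrow>\<^sup>*\<^bsub>G\<^esub> v"
  obtains w where "awalk u w v" "length w = graph_dist G u v"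
proof -
  have "\<exists>m w. awalk u w v \<and> length w = m"
    using assms reachable_awalk by blast
  then have "\<exists>w. awalk u w v \<and> length w = graph_dist G u v"
    unfolding graph_dist_def by (rule LeastI_ex)
  then show thesis using that by blast
qed

text \<open>The differences telescope along a shortest walk, each arc lowering \<open>f\<close> by
  at most 1. Reachability ensures that \<open>graph_dist\<close> is the length of an actual
  walk.\<close>

lemma graph_dist_ge_Lipschitz:
  fixes f :: "'a \<Rightarrow> real"
  assumes lip: "\<And>a b. a \<rightarrow>\<^bsub>G\<^esub> b \<Longrightarrow> f a - f b \<le> 1" and "u \<rightarrow>\<^sup>*\<^bsub>G\<^esub> v"
  shows "f u - f v \<le> real (graph_dist G u v)"
proof -
  obtain w where w: "awalk u w v" "length w = graph_dist G u v"
    using assms(2) by (rule graph_dist_awalk)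
  from w(1) have "f u - f v \<le> real (length w)"
  proof (induction w arbitrary: u)
    case Nil
    then show ?case by (simp add: awalk_Nil_iff)
  next
    case (Cons e es)
    then have "e \<in> arcs G" "u = tail G e" "awalk (head G e) es v"
      by (simp_all add: awalk_Cons_iff)
    with Cons.IH[of "head G e"] lip[of u "head G e"] show ?case
      by (auto dest: in_arcs_imp_in_arcs_ends)
  qed
  with w(2) show ?thesis by simp
qed

lemma graph_dist_self: "v \<in> verts G \<Longrightarrow> graph_dist G v v = 0"
  using graph_dist_le[of G v "[]" v] by (simp add: awalk_Nil_iff)

lemma graph_dist_dominates_le:
  assumes "u \<rightarrow>\<^bsub>G\<^esub> v" shows "graph_dist G u v \<le> 1"
proof -
  obtain e where "e \<in> arcs G" "tail G e = u" "head G e = v" using assms by blast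
  then have "awalk u [e] v" by (auto simp: awalk_simps)
  from graph_dist_le[OF this] show ?thesis by simp
qed

lemma graph_dist_dominates2_le:
  assumes "u \<rightarrow>\<^bsub>G\<^esub> v" "v \<rightarrow>\<^bsub>G\<^esub> w" shows "graph_dist G u w \<le> 2"
proof -
  obtain e e' where "e \<in> arcs G" "tail G e = u" "head G e = v"
    "e' \<in> arcs G" "tail G e' = v" "head G e' = w" using assms by blast
  then have "awalk u [e, e'] w" by (auto simp: awalk_simps)
  from graph_dist_le[OF this] show ?thesis by simp
qed

text \<open>By symmetry, walks into \<open>r\<close> can be reversed, so any two vertices are linked
  through \<open>r\<close>. This reduces each connectedness claim to the choice of a hub.\<close>

lemma connected_if_reachable_hub:
  assumes sym: "symmetric G" and r: "r \<in> verts G"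
    and hub: "\<And>u. u \<in> verts G \<Longrightarrow> u \<rightarrow>\<^sup>*\<^bsub>G\<^esub> r"
  shows "Digraph_Component.connected G"
  unfolding connected_conv
proof (intro conjI ballI)
  show "verts G \<noteq> {}" using r by blast
  fix u v assume "u \<in> verts G" "v \<in> verts G"
  then have "u \<rightarrow>\<^sup>*\<^bsub>G\<^esub> v"
    using hub reachable_trans symmetric_reachable[OF sym] by blast
  then show "(u, v) \<in> rtrancl_on (verts G) ((arcs_ends G)\<^sup>s)"
    unfolding reachable_def by (rule rtrancl_on_mono[rotated 2]) (auto simp: symcl_def)
qed

end

section \<open>Curvature from an optimal assignment\<close>

text \<open>Weak Kantorovich duality: the marginals alone determine the sum of
  \<open>(f u - f v) * \<rho> u v\<close>, and the Lipschitz bound makes it a lower bound for the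
  cost of every coupling. Complementary slackness (\<open>tight\<close>) makes \<open>\<pi>\<close>
  attain it.\<close>

lemma wasserstein_eq_dual:
  fixes f :: "'a \<Rightarrow> real"
  assumes lip: "\<And>u v. u \<in> verts G \<Longrightarrow> v \<in> verts G \<Longrightarrow> f u - f v \<le> real (graph_dist G u v)"
    and \<pi>: "\<pi> \<in> couplings G \<mu> \<nu>"
    and tight: "\<And>u v. u \<in> verts G \<Longrightarrow> v \<in> verts G \<Longrightarrow> \<pi> u v \<noteq> 0 \<Longrightarrow>
                  real (graph_dist G u v) = f u - f v"
  shows "wasserstein G \<mu> \<nu> = (\<Sum>u\<in>verts G. f u * \<mu> u) - (\<Sum>v\<in>verts G. f v * \<nu> v)"
proof -
  let ?V = "verts G"
  let ?cost = "\<lambda>\<rho>. \<Sum>u\<in>?V. \<Sum>v\<in>?V. real (graph_dist G u v) * \<rho> u v"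
  let ?D = "(\<Sum>u\<in>?V. f u * \<mu> u) - (\<Sum>v\<in>?V. f v * \<nu> v)"
  have dual: "(\<Sum>u\<in>?V. \<Sum>v\<in>?V. (f u - f v) * \<rho> u v) = ?D"
    if "\<rho> \<in> couplings G \<mu> \<nu>" for \<rho>
  proof -
    have "(\<Sum>u\<in>?V. \<Sum>v\<in>?V. f u * \<rho> u v) = (\<Sum>u\<in>?V. f u * \<mu> u)"
      using that by (simp add: couplings_def flip: sum_distrib_left)
    moreover have "(\<Sum>u\<in>?V. \<Sum>v\<in>?V. f v * \<rho> u v) = (\<Sum>v\<in>?V. f v * \<nu> v)"
      using that by (subst sum.swap) (simp add: couplings_def flip: sum_distrib_left)
    ultimately show ?thesis by (simp add: left_diff_distrib sum_subtractf)
  qed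
  have lower: "?D \<le> ?cost \<rho>" if "\<rho> \<in> couplings G \<mu> \<nu>" for \<rho>
    unfolding dual[OF that, symmetric]
    using that by (intro sum_mono mult_right_mono lip) (auto simp: couplings_def)
  have "?cost \<pi> = ?D"
    unfolding dual[OF \<pi>, symmetric] using tight by (intro sum.cong refl) auto
  with \<pi> lower show ?thesis
    unfolding wasserstein_def
    by (intro cInf_eq_minimum) (auto simp: image_iff intro: rev_bexI)
qed

text \<open>The vertex itself is included because the lazy measure is a uniform weight on this set
  plus a point mass at \<open>v\<close>.\<close>

definition closed_nbhd :: "('a, 'b) pre_digraph \<Rightarrow> 'a \<Rightarrow> 'a set" where
  "closed_nbhd G v = insert v {w. v \<rightarrow>\<^bsub>G\<^esub> w}"

context graph
begin

lemma closed_nbhd_subset: "v \<in> verts G \<Longrightarrow> closed_nbhd G v \<subseteq> verts G"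
  by (auto simp: closed_nbhd_def dest: adj_in_verts)

lemma card_closed_nbhd:
  assumes "v \<in> verts G" shows "card (closed_nbhd G v) = Suc (out_degree G v)"
proof -
  have "{w. v \<rightarrow>\<^bsub>G\<^esub> w} = head G ` out_arcs G v"
    by (auto simp: arcs_ends_conv)
  moreover have "inj_on (head G) (out_arcs G v)"
    by (auto intro!: inj_onI no_multi_arcs simp: arc_to_ends_def)
  ultimately have "card {w. v \<rightarrow>\<^bsub>G\<^esub> w} = out_degree G v"
    by (simp add: card_image out_degree_def)
  moreover have "finite {w. v \<rightarrow>\<^bsub>G\<^esub> w}" "v \<notin> {w. v \<rightarrow>\<^bsub>G\<^esub> w}"
    using adj_not_same by (auto intro: finite_subset[OF _ finite_verts] dest: adj_in_verts)
  ultimately show ?thesis by (simp add: closed_nbhd_def)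
qed

text \<open>The two summands are transported separately: the uniform one along a bijection, the
  point mass in one piece.\<close>

lemma lazy_measure_conv:
  fixes v u :: 'a and p :: real
  defines "s \<equiv> (1 - p) / real (out_degree G v)"
  shows "lazy_measure G p v u
           = (if u \<in> closed_nbhd G v then s else 0) + (if u = v then p - s else 0)"
  by (auto simp: lazy_measure_def closed_nbhd_def s_def)

text \<open>The coupling moves mass \<open>(1 - p) / k\<close> along \<open>\<phi>\<close> and the remaining surplus of \<open>x\<close> to \<open>y\<close>.
  It is nonnegative once \<open>p \<ge> 1 / (k + 1)\<close>, and \<open>f\<close> certifies its optimality.\<close>

lemma wasserstein_assignment:
  fixes f :: "'a \<Rightarrow> real" and x y :: 'a and p :: real
  assumes adj: "x \<rightarrow>\<^bsub>G\<^esub> y" and deg: "out_degree G x = k" "out_degree G y = k"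
    and bij: "bij_betw \<phi> (closed_nbhd G x) (closed_nbhd G y)"
    and lip: "\<And>u v. u \<in> verts G \<Longrightarrow> v \<in> verts G \<Longrightarrow> f u - f v \<le> real (graph_dist G u v)"
    and tight: "\<And>u. u \<in> closed_nbhd G x \<Longrightarrow> real (graph_dist G u (\<phi> u)) = f u - f (\<phi> u)"
    and xy: "real (graph_dist G x y) = f x - f y"
    and p: "(1 - p) / real k \<le> p" "p \<le> 1"
  shows "wasserstein G (lazy_measure G p x) (lazy_measure G p y)
    = (1 - p) / real k * (\<Sum>u\<in>closed_nbhd G x. real (graph_dist G u (\<phi> u)))
      + (p - (1 - p) / real k) * real (graph_dist G x y)"
proof -
  let ?V = "verts G" and ?X = "closed_nbhd G x" and ?Y = "closed_nbhd G y"
  let ?d = "\<lambda>u v. real (graph_dist G u v)"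
  define s where "s = (1 - p) / real k"
  have s: "0 \<le> s" "s \<le> p" using p by (auto simp: s_def)
  have xV: "x \<in> ?V" and yV: "y \<in> ?V" using adj by (auto dest: adj_in_verts)
  have XV: "?X \<subseteq> ?V" and YV: "?Y \<subseteq> ?V" using closed_nbhd_subset xV yV by auto
  have \<phi>Y: "\<phi> u \<in> ?Y" if "u \<in> ?X" for u using that bij by (auto simp: bij_betw_def)
  have \<mu>x: "lazy_measure G p x = (\<lambda>u. (if u \<in> ?X then s else 0) + (if u = x then p - s else 0))"
    and \<mu>y: "lazy_measure G p y = (\<lambda>u. (if u \<in> ?Y then s else 0) + (if u = y then p - s else 0))"
    using lazy_measure_conv deg by (auto simp: s_def fun_eq_iff)
  have point_sum: "(\<Sum>u\<in>?V. f u * ((if u \<in> B then s else 0) + (if u = b then p - s else 0)))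
      = s * (\<Sum>u\<in>B. f u) + (p - s) * f b" if "B \<subseteq> ?V" "b \<in> ?V" for B b
  proof -
    have "(\<Sum>u\<in>?V. f u * (if u \<in> B then s else 0)) = (\<Sum>u\<in>B. s * f u)"
      by (rule sum.mono_neutral_cong_right) (use that in auto)
    moreover have "(\<Sum>u\<in>?V. f u * (if u = b then p - s else 0)) = (\<Sum>u\<in>{b}. (p - s) * f u)"
      by (rule sum.mono_neutral_cong_right) (use that in auto)
    ultimately show ?thesis
      by (simp add: distrib_left sum.distrib sum_distrib_left)
  qed
  define \<pi> where "\<pi> = (\<lambda>u v. (if u \<in> ?X \<and> v = \<phi> u then s else 0)
                              + (if u = x \<and> v = y then p - s else 0))"
  have "\<pi> \<in> couplings G (lazy_measure G p x) (lazy_measure G p y)"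
    unfolding couplings_def
  proof (intro CollectI conjI ballI)
    \<comment> \<open>If \<open>\<phi> x = y\<close>, both summands apply at \<open>(x, y)\<close>,
      and they add up to \<open>p\<close>, which is at most 1.\<close>
    fix u v show "\<pi> u v \<in> {0..1}" using s p by (auto simp: \<pi>_def)
  next
    fix u assume "u \<in> ?V"
    have "(\<Sum>v\<in>?V. if u \<in> ?X \<and> v = \<phi> u then s else 0) = (if u \<in> ?X then s else 0)"
      using \<phi>Y YV by (auto simp: sum.delta)
    moreover have "(\<Sum>v\<in>?V. if u = x \<and> v = y then p - s else 0) = (if u = x then p - s else 0)"
      using yV by (auto simp: sum.delta)
    ultimately show "(\<Sum>v\<in>?V. \<pi> u v) = lazy_measure G p x u"
      by (simp add: \<pi>_def \<mu>x sum.distrib)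
  next
    fix v assume "v \<in> ?V"
    \<comment> \<open>Column sums range over \<open>u\<close>; inverting \<open>\<phi>\<close> turns
      the condition into an equation for \<open>u\<close>, so at most one term survives.\<close>
    let ?\<psi> = "the_inv_into ?X \<phi>"
    have inv: "u \<in> ?X \<and> v = \<phi> u \<longleftrightarrow> v \<in> ?Y \<and> u = ?\<psi> v" for u
    proof
      assume "u \<in> ?X \<and> v = \<phi> u"
      then show "v \<in> ?Y \<and> u = ?\<psi> v"
        using bij \<phi>Y by (simp add: bij_betw_def the_inv_into_f_f)
    next
      assume *: "v \<in> ?Y \<and> u = ?\<psi> v"
      with bij have "\<phi> u = v" by (simp add: f_the_inv_into_f_bij_betw)
      moreover have "u \<in> ?X"
        using * bij_betw_the_inv_into[OF bij] bij_betw_apply by fast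
      ultimately show "u \<in> ?X \<and> v = \<phi> u" by simp
    qed
    have "v \<in> ?Y \<Longrightarrow> ?\<psi> v \<in> ?V" using inv XV by blast
    then have "(\<Sum>u\<in>?V. if u \<in> ?X \<and> v = \<phi> u then s else 0) = (if v \<in> ?Y then s else 0)"
      unfolding inv by (auto simp: sum.delta)
    moreover have "(\<Sum>u\<in>?V. if u = x \<and> v = y then p - s else 0) = (if v = y then p - s else 0)"
      using xV by (auto simp: sum.delta)
    ultimately show "(\<Sum>u\<in>?V. \<pi> u v) = lazy_measure G p y v"
      by (simp add: \<pi>_def \<mu>y sum.distrib)
  qed
  then have "wasserstein G (lazy_measure G p x) (lazy_measure G p y)
      = (\<Sum>u\<in>?V. f u * lazy_measure G p x u) - (\<Sum>v\<in>?V. f v * lazy_measure G p y v)"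
    using tight xy by (intro wasserstein_eq_dual lip) (auto simp: \<pi>_def split: if_splits)
  also have "(\<Sum>u\<in>?V. f u * lazy_measure G p x u) = s * (\<Sum>u\<in>?X. f u) + (p - s) * f x"
    unfolding \<mu>x by (rule point_sum[OF XV xV])
  also have "(\<Sum>v\<in>?V. f v * lazy_measure G p y v) = s * (\<Sum>v\<in>?Y. f v) + (p - s) * f y"
    unfolding \<mu>y by (rule point_sum[OF YV yV])
  also have "(\<Sum>v\<in>?Y. f v) = (\<Sum>u\<in>?X. f (\<phi> u))"
    using bij by (simp add: sum.reindex_bij_betw)
  finally have "wasserstein G (lazy_measure G p x) (lazy_measure G p y)
      = s * ((\<Sum>u\<in>?X. f u) - (\<Sum>u\<in>?X. f (\<phi> u))) + (p - s) * (f x - f y)"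
    by (simp add: algebra_simps)
  also have "(\<Sum>u\<in>?X. f u) - (\<Sum>u\<in>?X. f (\<phi> u)) = (\<Sum>u\<in>?X. ?d u (\<phi> u))"
    by (simp add: tight sum_subtractf)
  finally show ?thesis by (simp add: s_def xy)
qed

text \<open>Since \<open>x\<close> and \<open>y\<close> are at distance 1, the surplus costs exactly
  its mass. The curvature for \<open>p\<close> near 1 is then \<open>1 - p\<close> times a constant,
  so the quotient is eventually constant.\<close>

lemma has_LLY_curvature_assignment:
  fixes f :: "'a \<Rightarrow> real"
  assumes adj: "x \<rightarrow>\<^bsub>G\<^esub> y" and deg: "out_degree G x = k" "out_degree G y = k"
    and bij: "bij_betw \<phi> (closed_nbhd G x) (closed_nbhd G y)"
    and lip: "\<And>u v. u \<in> verts G \<Longrightarrow> v \<in> verts G \<Longrightarrow> f u - f v \<le> real (graph_dist G u v)"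
    and tight: "\<And>u. u \<in> closed_nbhd G x \<Longrightarrow> real (graph_dist G u (\<phi> u)) = f u - f (\<phi> u)"
    and xy: "f x - f y = 1"
  shows "has_LLY_curvature G x y
    ((real k + 1 - (\<Sum>u\<in>closed_nbhd G x. real (graph_dist G u (\<phi> u)))) / real k)"
proof -
  let ?C = "\<Sum>u\<in>closed_nbhd G x. real (graph_dist G u (\<phi> u))"
  have V: "x \<in> verts G" "y \<in> verts G" using adj by (auto dest: adj_in_verts)
  have dxy: "graph_dist G x y = 1"
    using lip[OF V] graph_dist_dominates_le[OF adj] xy by simp
  have "k > 0"
  proof -
    have "closed_nbhd G x \<supseteq> {x, y}" "x \<noteq> y"
      using adj adj_not_same by (auto simp: closed_nbhd_def)
    then have "2 \<le> card (closed_nbhd G x)"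
      using card_mono[of "closed_nbhd G x" "{x, y}"] closed_nbhd_subset[OF V(1)]
        finite_subset[OF _ finite_verts] by fastforce
    then show ?thesis using card_closed_nbhd[OF V(1)] deg by simp
  qed
  \<comment> \<open>The bound 1/2 works for all \<open>k \<ge> 1\<close>: there
    \<open>(1 - p) / k \<le> 1 - p < p\<close>.\<close>
  have "eventually (\<lambda>p. p \<in> {1/2<..<1}) (at_left (1::real))"
    by (rule eventually_at_leftI[of "1/2"]) auto
  then have "eventually (\<lambda>p. ollivier_curvature G p x y / (1 - p) = (real k + 1 - ?C) / real k)
      (at_left 1)"
  proof (rule eventually_mono)
    fix p :: real assume p: "p \<in> {1/2<..<1}"
    have "(1 - p) / real k \<le> (1 - p) / 1"
      using p \<open>k > 0\<close> by (intro divide_left_mono) auto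
    then have "(1 - p) / real k \<le> p" "p \<le> 1" using p by auto
    from wasserstein_assignment[OF adj deg bij lip tight _ this]
    have "ollivier_curvature G p x y
        = 1 - ((1 - p) / real k * ?C + (p - (1 - p) / real k))"
      by (simp add: ollivier_curvature_def dxy xy)
    also have "\<dots> = (1 - p) * ((real k + 1 - ?C) / real k)"
      using \<open>k > 0\<close> by (simp add: field_simps)
    finally show "ollivier_curvature G p x y / (1 - p) = (real k + 1 - ?C) / real k"
      using p by simp
  qed
  then show ?thesis
    unfolding has_LLY_curvature_def by (rule tendsto_eventually)
qed

end

section \<open>Graphs from adjacency relations\<close>

text \<open>Taking ordered pairs as arcs excludes parallel arcs, and the built-in
  \<open>u \<noteq> v\<close> allows \<open>E\<close> to be reflexive.\<close>

definition simple_graph :: "'a set \<Rightarrow> ('a \<Rightarrow> 'a \<Rightarrow> bool) \<Rightarrow> ('a, 'a \<times> 'a) pre_digraph" where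
  "simple_graph V E =
     \<lparr>verts = V, arcs = {(u, v). u \<in> V \<and> v \<in> V \<and> u \<noteq> v \<and> E u v}, tail = fst, head = snd\<rparr>"

lemma verts_simple_graph [simp]: "verts (simple_graph V E) = V"
  by (simp add: simple_graph_def)

lemma dominates_simple_graph [simp]:
  "u \<rightarrow>\<^bsub>simple_graph V E\<^esub> v \<longleftrightarrow> u \<in> V \<and> v \<in> V \<and> u \<noteq> v \<and> E u v"
  by (force simp: simple_graph_def arcs_ends_conv)

lemma wf_digraph_simple_graph: "wf_digraph (simple_graph V E)"
  by unfold_locales (auto simp: simple_graph_def)

lemma symmetric_simple_graph: "symp E \<Longrightarrow> symmetric (simple_graph V E)"
  unfolding symmetric_def by (rule symI) (auto dest: sympD)

lemma graph_simple_graph: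
  assumes "finite V" "symp E" shows "graph (simple_graph V E)"
proof -
  have "finite (arcs (simple_graph V E))"
    by (rule finite_subset[of _ "V \<times> V"]) (auto simp: simple_graph_def assms)
  with assms symmetric_simple_graph[OF assms(2)] show ?thesis
    by unfold_locales (auto simp: simple_graph_def arc_to_ends_def)
qed

lemma induce_subgraph_simple_graph:
  "U \<subseteq> V \<Longrightarrow> induce_subgraph (simple_graph V E) U = simple_graph U E"
  by (force simp: induce_subgraph_def simple_graph_def)

section \<open>The extremal graph\<close>

text \<open>A pentagon \<open>Px, Xs, Far, Ys, Py\<close> in which \<open>Xs\<close>, \<open>Far\<close> and \<open>Ys\<close> are blown up to cliques of
  size \<open>m\<close>, joined completely to a clique \<open>Common\<close> of size \<open>t\<close>. The vertices \<open>0\<close> and \<open>1\<close> are the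
  parts \<open>Px\<close> and \<open>Py\<close>.\<close>

datatype part = Px | Py | Xs | Ys | Far | Common

text \<open>These are the five diagonals of the pentagon, each in one orientation;
  \<open>part_adj\<close> symmetrises. No part is paired with itself, so parts become
  cliques.\<close>

fun non_adjacent :: "part \<Rightarrow> part \<Rightarrow> bool" where
  "non_adjacent Px Ys = True"
| "non_adjacent Px Far = True"
| "non_adjacent Py Xs = True"
| "non_adjacent Py Far = True"
| "non_adjacent Xs Ys = True"
| "non_adjacent _ _ = False"

text \<open>\<open>Xs\<close> and \<open>Ys\<close> are consecutive blocks of length
  \<open>m\<close>, so adding \<open>m\<close> matches them. \<open>Common\<close> comes last, its
  size being set by the vertex set.\<close>

definition part_of :: "nat \<Rightarrow> nat \<Rightarrow> part" where
  "part_of m v = (if v = 0 then Px else if v = 1 then Py else if v < 2 + m then Xs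
     else if v < 2 + 2 * m then Ys else if v < 2 + 3 * m then Far else Common)"

definition part_adj :: "nat \<Rightarrow> nat \<Rightarrow> nat \<Rightarrow> bool" where
  "part_adj m u v \<longleftrightarrow>
     \<not> non_adjacent (part_of m u) (part_of m v) \<and> \<not> non_adjacent (part_of m v) (part_of m u)"

fun potential :: "part \<Rightarrow> real" where
  "potential Xs = 2"
| "potential Py = 0"
| "potential Ys = 0"
| "potential _ = 1"

lemma symp_part_adj: "symp (part_adj m)"
  by (auto simp: symp_def part_adj_def)

text \<open>A drop of 2 occurs only from \<open>Xs\<close> to \<open>Py\<close> or
  \<open>Ys\<close>, and neither is adjacent to \<open>Xs\<close>.\<close>

lemma potential_diff_le:
  "part_adj m u v \<Longrightarrow> potential (part_of m u) - potential (part_of m v) \<le> 1"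
  unfolding part_adj_def by (cases "part_of m u"; cases "part_of m v") simp_all

definition extremal :: "nat \<Rightarrow> nat \<Rightarrow> (nat, nat \<times> nat) pre_digraph" where
  "extremal m t = simple_graph {..<2 + 3 * m + t} (part_adj m)"

lemma verts_extremal [simp]: "verts (extremal m t) = {..<2 + 3 * m + t}"
  by (simp add: extremal_def)

lemma dominates_extremal:
  "u \<rightarrow>\<^bsub>extremal m t\<^esub> v \<longleftrightarrow> u < 2 + 3 * m + t \<and> v < 2 + 3 * m + t \<and> u \<noteq> v \<and> part_adj m u v"
  by (simp add: extremal_def)

lemma graph_extremal: "graph (extremal m t)"
  unfolding extremal_def by (intro graph_simple_graph symp_part_adj) simp

lemma closed_nbhd_extremal:
  "closed_nbhd (extremal m t) 0 = {..<2 + m} \<union> {2 + 3 * m..<2 + 3 * m + t}"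
  "closed_nbhd (extremal m t) 1 = {..<2} \<union> {2 + m..<2 + 2 * m} \<union> {2 + 3 * m..<2 + 3 * m + t}"
  by (auto simp: closed_nbhd_def dominates_extremal part_adj_def part_of_def split: if_splits)

lemma out_degree_extremal:
  "out_degree (extremal m t) 0 = 1 + m + t" "out_degree (extremal m t) 1 = 1 + m + t"
proof -
  interpret graph "extremal m t" by (rule graph_extremal)
  have "card (closed_nbhd (extremal m t) 0) = 2 + m + t"
    unfolding closed_nbhd_extremal by (subst card_Un_disjoint) auto
  then show "out_degree (extremal m t) 0 = 1 + m + t" using card_closed_nbhd[of 0] by simp
  have "card (closed_nbhd (extremal m t) 1) = 2 + m + t"
    unfolding closed_nbhd_extremal by (subst card_Un_disjoint; auto)+
  then show "out_degree (extremal m t) 1 = 1 + m + t" using card_closed_nbhd[of 1] by simp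
qed

text \<open>A surviving vertex of \<open>Common\<close> is adjacent to everything and serves as hub.
  Otherwise at most \<open>m\<close> further vertices are deleted; the hub is a surviving vertex of
  \<open>Far\<close>, or \<open>0\<close> if there is none.\<close>

lemma connected_extremal_minus:
  assumes S: "S \<subseteq> {..<2 + 3 * m + t}" and card_S: "card S < 1 + m + t"
  shows "Digraph_Component.connected (simple_graph ({..<2 + 3 * m + t} - S) (part_adj m))"
proof -
  let ?U = "{..<2 + 3 * m + t} - S" and ?C = "{2 + 3 * m..<2 + 3 * m + t}"
  let ?H = "simple_graph ?U (part_adj m)"
  interpret wf_digraph ?H by (rule wf_digraph_simple_graph)
  have dom: "u \<rightarrow>\<^bsub>?H\<^esub> v \<longleftrightarrow> u \<in> ?U \<and> v \<in> ?U \<and> u \<noteq> v \<and> part_adj m u v" for u v by simp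
  have step: "u \<rightarrow>\<^sup>*\<^bsub>?H\<^esub> v" if "u \<in> ?U" "v \<in> ?U" "part_adj m u v" for u v
  proof (cases "u = v")
    case True
    have "u \<in> verts ?H" using that by (simp only: verts_simple_graph)
    then show ?thesis unfolding True[symmetric] by (rule reachable_refl)
  next
    case False
    with that dom have "u \<rightarrow>\<^bsub>?H\<^esub> v" by blast
    then show ?thesis by (rule reachable_adjI)
  qed
  note hubI = connected_if_reachable_hub[OF symmetric_simple_graph[OF symp_part_adj]]
  \<comment> \<open>As \<open>S\<close> has at most \<open>m + t\<close> elements,
    \<open>Common\<close> and \<open>m\<close> further deleted vertices exhaust it.\<close>
  have S_eq: "S = P \<union> ?C" if "?C \<subseteq> S" "P \<subseteq> S" "P \<subseteq> {..<2 + 3 * m}" "card P = m" for P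
  proof -
    have "card (P \<union> ?C) = m + t"
      using that finite_subset[of P "{..<2 + 3 * m}"] by (subst card_Un_disjoint) auto
    then show ?thesis
      using card_seteq[of S "P \<union> ?C"] that card_S finite_subset[OF S] by auto
  qed
  consider (common) c where "c \<in> ?C" "c \<notin> S"
    | (far) "?C \<subseteq> S" "{2 + 2 * m..<2 + 3 * m} \<subseteq> S"
    | (no_far) r where "?C \<subseteq> S" "r \<in> {2 + 2 * m..<2 + 3 * m}" "r \<notin> S"
    by blast
  then show ?thesis
  proof cases
    case common
    show ?thesis
    proof (rule hubI)
      show "c \<in> verts ?H" using common by auto
      fix u assume "u \<in> verts ?H"
      with common show "u \<rightarrow>\<^sup>*\<^bsub>?H\<^esub> c" by (intro step) (auto simp: part_adj_def part_of_def)
    qed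
  next
    case far
    \<comment> \<open>What remains is the blown-up path \<open>Xs, Px, Py, Ys\<close>.\<close>
    have eq: "S = {2 + 2 * m..<2 + 3 * m} \<union> ?C" by (rule S_eq) (use far in auto)
    have U: "0 \<in> ?U" "1 \<in> ?U" unfolding eq by auto
    show ?thesis
    proof (rule hubI)
      show "0 \<in> verts ?H" using U by simp
      fix u assume "u \<in> verts ?H"
      then have u: "u \<in> ?U" "u < 2 + 2 * m" by (auto simp: eq)
      show "u \<rightarrow>\<^sup>*\<^bsub>?H\<^esub> 0"
      proof (cases "u < 2 + m")
        case True
        with u U show ?thesis by (intro step) (auto simp: part_adj_def part_of_def)
      next
        case False
        with u U have "u \<rightarrow>\<^sup>*\<^bsub>?H\<^esub> 1" by (intro step) (auto simp: part_adj_def part_of_def)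
        also from U have "1 \<rightarrow>\<^sup>*\<^bsub>?H\<^esub> 0" by (intro step) (auto simp: part_adj_def part_of_def)
        finally show ?thesis .
      qed
    qed
  next
    case no_far
    have r: "r \<in> ?U" using no_far by auto
    have "m > 0" using no_far by auto
    \<comment> \<open>\<open>Far\<close> is adjacent to every part except \<open>Px\<close> and
      \<open>Py\<close>; only \<open>0\<close> and \<open>1\<close> need a detour.\<close>
    have near: "u \<rightarrow>\<^sup>*\<^bsub>?H\<^esub> r" if "u \<in> ?U" "2 \<le> u" for u
      using that no_far r by (intro step) (auto simp: part_adj_def part_of_def)
    have x: "0 \<rightarrow>\<^sup>*\<^bsub>?H\<^esub> r" if "a \<in> {2..<2 + m}" "a \<notin> S" "0 \<notin> S" for a
    proof -
      have "0 \<rightarrow>\<^sup>*\<^bsub>?H\<^esub> a"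
        using that by (intro step) (auto simp: part_adj_def part_of_def)
      also have "a \<rightarrow>\<^sup>*\<^bsub>?H\<^esub> r" using that by (intro near) auto
      finally show ?thesis .
    qed
    have y: "1 \<rightarrow>\<^sup>*\<^bsub>?H\<^esub> r" if "b \<in> {2 + m..<2 + 2 * m}" "b \<notin> S" "1 \<notin> S" for b
    proof -
      have "1 \<rightarrow>\<^sup>*\<^bsub>?H\<^esub> b"
        using that by (intro step) (auto simp: part_adj_def part_of_def)
      also have "b \<rightarrow>\<^sup>*\<^bsub>?H\<^esub> r" using that by (intro near) auto
      finally show ?thesis .
    qed
    have xy: "0 \<rightarrow>\<^sup>*\<^bsub>?H\<^esub> 1" "1 \<rightarrow>\<^sup>*\<^bsub>?H\<^esub> 0" if "0 \<notin> S" "1 \<notin> S"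
      using that by (intro step; simp add: part_adj_def part_of_def)+
    show ?thesis
    proof (rule hubI)
      show "r \<in> verts ?H" using r by simp
      fix u assume "u \<in> verts ?H"
      then have "u \<in> ?U" by simp
      consider "u \<ge> 2" | "u = 0" | "u = 1" by linarith
      then show "u \<rightarrow>\<^sup>*\<^bsub>?H\<^esub> r"
      proof cases
        case 1
        with \<open>u \<in> ?U\<close> show ?thesis by (intro near)
      next
        case 2
        show ?thesis
        proof (cases "{2..<2 + m} \<subseteq> S")
          \<comment> \<open>With \<open>Xs\<close> gone nothing of the pentagon can be missing
            besides it, so \<open>0\<close> goes through \<open>1\<close> and the vertex
            \<open>2 + m\<close> of \<open>Ys\<close>. The case of \<open>1\<close> below mirrors
            this.\<close>
          case True
          have "S = {2..<2 + m} \<union> ?C" by (rule S_eq) (use True no_far in auto)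
          with \<open>m > 0\<close> have "2 + m \<notin> S" "1 \<notin> S" "0 \<notin> S" by auto
          then have "0 \<rightarrow>\<^sup>*\<^bsub>?H\<^esub> 1" "1 \<rightarrow>\<^sup>*\<^bsub>?H\<^esub> r"
            using xy y[of "2 + m"] \<open>m > 0\<close> by auto
          then show ?thesis unfolding 2 by (rule reachable_trans)
        next
          case False
          then obtain a where "a \<in> {2..<2 + m}" "a \<notin> S" by blast
          with 2 \<open>u \<in> ?U\<close> show ?thesis using x by simp
        qed
      next
        case 3
        show ?thesis
        proof (cases "{2 + m..<2 + 2 * m} \<subseteq> S")
          case True
          have "S = {2 + m..<2 + 2 * m} \<union> ?C" by (rule S_eq) (use True no_far in auto)
          with \<open>m > 0\<close> have "2 \<notin> S" "1 \<notin> S" "0 \<notin> S" by auto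
          then have "1 \<rightarrow>\<^sup>*\<^bsub>?H\<^esub> 0" "0 \<rightarrow>\<^sup>*\<^bsub>?H\<^esub> r"
            using xy x[of 2] \<open>m > 0\<close> by auto
          then show ?thesis unfolding 3 by (rule reachable_trans)
        next
          case False
          then obtain b where "b \<in> {2 + m..<2 + 2 * m}" "b \<notin> S" by blast
          with 3 \<open>u \<in> ?U\<close> show ?thesis using y by simp
        qed
      qed
    qed
  qed
qed

lemma connectivity_extremal: "connectivity (extremal m t) = 1 + m + t"
proof (cases "m = 0")
  \<comment> \<open>Without blown-up parts the graph is complete on \<open>2 + t\<close> vertices,
    where the connectivity is set by convention.\<close>
  case True
  have "complete_digraph (card (verts (extremal m t))) (extremal m t)"
    unfolding complete_digraph_def using True
    by (auto simp: graph_extremal dominates_extremal part_adj_def part_of_def)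
  with True show ?thesis by (simp add: connectivity_def)
next
  case False
  let ?V = "{..<2 + 3 * m + t}"
  have incomplete: "\<not> complete_digraph (card (verts (extremal m t))) (extremal m t)"
  proof
    assume "complete_digraph (card (verts (extremal m t))) (extremal m t)"
    with False have "0 \<rightarrow>\<^bsub>extremal m t\<^esub> (2 + m)" by (simp add: complete_digraph_def)
    with False show False by (simp add: dominates_extremal part_adj_def part_of_def)
  qed
  have induced: "induce_subgraph (extremal m t) (?V - S) = simple_graph (?V - S) (part_adj m)" for S
    unfolding extremal_def by (rule induce_subgraph_simple_graph) auto
  \<comment> \<open>This is the neighbourhood of \<open>0\<close>, namely \<open>Py\<close>,
    \<open>Xs\<close> and \<open>Common\<close>. Deleting it isolates \<open>0\<close>, while
    \<open>2 + m\<close> in \<open>Ys\<close> survives.\<close>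
  let ?S = "{1..<2 + m} \<union> {2 + 3 * m..<2 + 3 * m + t}"
  let ?H = "simple_graph (?V - ?S) (part_adj m)"
  have "\<not> Digraph_Component.connected ?H"
  proof
    interpret wf_digraph ?H by (rule wf_digraph_simple_graph)
    assume "Digraph_Component.connected ?H"
    then have "strongly_connected ?H"
      by (intro symmetric_connected_imp_strongly_connected symmetric_simple_graph symp_part_adj)
    with False have "0 \<rightarrow>\<^sup>*\<^bsub>?H\<^esub> (2 + m)" by (auto simp: strongly_connected_def)
    then show False
      by (cases rule: converse_reachable_cases)
        (auto simp: part_adj_def part_of_def split: if_splits)
  qed
  moreover have "card ?S = 1 + m + t" by (subst card_Un_disjoint) auto
  ultimately have "(LEAST s. \<exists>S \<subseteq> ?V. card S = s \<and>
      \<not> Digraph_Component.connected (simple_graph (?V - S) (part_adj m))) = 1 + m + t"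
    using connected_extremal_minus
    by (intro Least_equality exI[of _ ?S]) (auto simp: not_le[symmetric])
  with incomplete show ?thesis unfolding connectivity_def verts_extremal induced by simp
qed

lemma has_LLY_curvature_extremal:
  "has_LLY_curvature (extremal m t) 0 1 ((2 + real t - real m) / (1 + real m + real t))"
proof -
  interpret graph "extremal m t" by (rule graph_extremal)
  let ?G = "extremal m t" and ?C = "{2 + 3 * m..<2 + 3 * m + t}"
  define f where "f v = potential (part_of m v)" for v
  \<comment> \<open>The assignment shifts \<open>Xs\<close> onto \<open>Ys\<close> and fixes
    \<open>0\<close>, \<open>1\<close> and \<open>Common\<close>, so its total cost is
    \<open>2 * m\<close>.\<close>
  define \<phi> where "\<phi> u = (if u \<in> {2..<2 + m} then u + m else u)" for u
  have "strongly_connected ?G"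
    using connected_extremal_minus[of "{}" m t] symmetric_connected_imp_strongly_connected
    by (simp add: extremal_def symmetric_simple_graph symp_part_adj)
  then have lip: "f u - f v \<le> real (graph_dist ?G u v)" if "u \<in> verts ?G" "v \<in> verts ?G" for u v
    using that by (intro graph_dist_ge_Lipschitz)
      (auto simp: strongly_connected_def dominates_extremal f_def potential_diff_le)
  have bij: "bij_betw \<phi> (closed_nbhd ?G 0) (closed_nbhd ?G 1)"
    unfolding closed_nbhd_extremal
    by (rule bij_betw_byWitness[where f' = "\<lambda>v. if v \<in> {2 + m..<2 + 2 * m} then v - m else v"])
      (auto simp: \<phi>_def split: if_splits)
  have gap: "f u - f (\<phi> u) = (if u \<in> {2..<2 + m} then 2 else 0)" for u
    by (auto simp: f_def \<phi>_def part_of_def)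
  have tight: "real (graph_dist ?G u (\<phi> u)) = f u - f (\<phi> u)" if u: "u \<in> closed_nbhd ?G 0" for u
  proof (cases "u \<in> {2..<2 + m}")
    case True
    \<comment> \<open>The midpoint \<open>2 + 2 * m\<close> is the first vertex of
      \<open>Far\<close>; it exists because \<open>u\<close> in \<open>Xs\<close> forces
      \<open>m > 0\<close>.\<close>
    then have "u \<rightarrow>\<^bsub>?G\<^esub> (2 + 2 * m)" "(2 + 2 * m) \<rightarrow>\<^bsub>?G\<^esub> \<phi> u"
      by (auto simp: dominates_extremal part_adj_def part_of_def \<phi>_def)
    then have "graph_dist ?G u (\<phi> u) \<le> 2" by (rule graph_dist_dominates2_le)
    moreover have "f u - f (\<phi> u) \<le> real (graph_dist ?G u (\<phi> u))"
      using True by (intro lip) (auto simp: \<phi>_def)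
    ultimately show ?thesis using True gap[of u] by simp
  next
    case False
    then have "\<phi> u = u" by (simp only: \<phi>_def if_False)
    moreover have "u \<in> verts ?G" using u closed_nbhd_subset[of 0] by auto
    ultimately show ?thesis by (simp add: graph_dist_self)
  qed
  have "(\<Sum>u\<in>closed_nbhd ?G 0. real (graph_dist ?G u (\<phi> u)))
      = (\<Sum>u\<in>closed_nbhd ?G 0. if u \<in> {2..<2 + m} then 2 else 0)"
    by (rule sum.cong) (simp_all only: tight gap)
  also have "\<dots> = (\<Sum>u\<in>{2..<2 + m}. 2)"
    by (rule sum.mono_neutral_cong_right) (auto simp: closed_nbhd_extremal)
  finally have cost: "(\<Sum>u\<in>closed_nbhd ?G 0. real (graph_dist ?G u (\<phi> u))) = 2 * real m"
    by simp
  have "0 \<rightarrow>\<^bsub>?G\<^esub> 1" by (simp add: dominates_extremal part_adj_def part_of_def)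
  then have "has_LLY_curvature ?G 0 1 ((real (1 + m + t) + 1 - 2 * real m) / real (1 + m + t))"
    unfolding cost[symmetric]
    by (rule has_LLY_curvature_assignment[OF _ out_degree_extremal bij lip tight])
      (simp_all add: f_def part_of_def)
  then show ?thesis by (simp add: algebra_simps)
qed

theorem theorem1p8:
  fixes n k :: nat
  assumes "n > 0" and "k > 0"
    and "odd (int n - int k)"
    and "(real n + 1) / 3 \<le> real k" and "real k \<le> real n - 1"
  shows "\<exists>(G :: (nat, nat \<times> nat) pre_digraph) x y.
           graph G \<and> card (verts G) = n \<and> connectivity G = k \<and>
           x \<in> verts G \<and> y \<in> verts G \<and> x \<rightarrow>\<^bsub>G\<^esub> y \<and>
           out_degree G x = k \<and> out_degree G y = k \<and>
           has_LLY_curvature G x y ((2 * real k - real n + 2) / real k)"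
proof -
  have "k < n" using assms by linarith
  moreover have "real (n + 1) \<le> real (3 * k)" using assms(4) by simp
  then have "n + 1 \<le> 3 * k" by (simp only: of_nat_le_iff)
  moreover obtain j where "int n - int k = 2 * j + 1" using assms(3) by (rule oddE)
  \<comment> \<open>Since \<open>k < n\<close>, the integer \<open>j\<close> is nonnegative.\<close>
  ultimately obtain m where m: "n = k + 2 * m + 1" by (intro that[of "nat j"]) linarith
  \<comment> \<open>The subtraction does not truncate: \<open>n + 1 \<le> 3 * k\<close> with
    \<open>n = k + 2 * m + 1\<close> gives \<open>m + 1 \<le> k\<close>.\<close>
  define t where "t = k - 1 - m"
  have k: "k = 1 + m + t" and n: "n = 2 + 3 * m + t"
    using m \<open>n + 1 \<le> 3 * k\<close> by (auto simp: t_def)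
  have "(2 * real k - real n + 2) / real k = (2 + real t - real m) / (1 + real m + real t)"
    by (simp add: k n algebra_simps)
  moreover have "0 \<rightarrow>\<^bsub>extremal m t\<^esub> 1"
    by (simp add: dominates_extremal part_adj_def part_of_def)
  ultimately show ?thesis
    using graph_extremal connectivity_extremal out_degree_extremal has_LLY_curvature_extremal
    by (intro exI[of _ "extremal m t"] exI[of _ 0] exI[of _ 1]) (simp add: k n)
qed

end
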